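(* Let $H_+$ be an irreflexive purple graph (every edge is both red and blue) with a min-ordering $\le$. Let $r$ be a vertex of $H_+$ and $L$ a set of leaves (degree-one vertices) of $H_+$, and let $\mathcal{B}$ be the set of blue edges consisting of all blue edges of $H_+$ with both endpoints above $r$ (i.e. strictly greater than $r$ in $\le$) together with blue edges incident to vertices of $L$. Let $H$ be the br-graph obtained from $H_+$ by removing the blue colour from the edges of $\mathcal{B}$ (the red edges are kept). Then the switching graph $\mathcal{P}_H$ has a semi-conservative ternary WNU-polymorphism.
   Context: A br-graph is a pair of graphs (red edges, blue edges) on a common vertex set; an edge both red and blue is purple. A min-ordering of a graph is a linear order $\le$ of its vertices such that whenever $ab'$ and $a'b$ are edges, $\min(a,a')\min(b,b')$ is an edge. The switching graph $\mathcal{P}_H$ has vertex set $V(H)\times\{1,2\}$ with switch map $s:(v,1)\leftrightarrow(v,2)$; each red edge $uv$ of $H$ gives red edges $(u,1)(v,1)$, $(u,2)(v,2)$ and blue edges $(u,1)(v,2)$, $(u,2)(v,1)$, and each blue edge $uv$ gives blue edges $(u,1)(v,1)$, $(u,2)(v,2)$ and red edges $(u,1)(v,2)$, $(u,2)(v,1)$. A ternary polymorphism of $\mathcal{P}_H$ is a map $\phi:V(\mathcal{P}_H)^3\to V(\mathcal{P}_H)$ that maps triples of red (resp. blue) edges coordinatewise to a red (resp. blue) edge. It is semi-conservative if $\phi(S^3)\subseteq S$ for every $S$ with $s(S)=S$, and WNU if $\phi(x,x,x)=x$ and $\phi(x,x,y)=\phi(x,y,x)=\phi(y,x,x)$ for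 all $x,y$. *)

theory Defs
  imports Main
begin

text \<open>
  Graphs are undirected and loops are allowed: an edge set is a symmetric relation on the vertex
  set. No finiteness is assumed.
\<close>

record 'a br_graph =
  verts :: "'a set"
  red :: "('a \<times> 'a) set"
  blue :: "('a \<times> 'a) set"

definition is_graph :: "'a set \<Rightarrow> ('a \<times> 'a) set \<Rightarrow> bool" where
  "is_graph V E \<longleftrightarrow> E \<subseteq> V \<times> V \<and> sym E"

definition is_br_graph :: "'a br_graph \<Rightarrow> bool" where
  "is_br_graph H \<longleftrightarrow> is_graph (verts H) (red H) \<and> is_graph (verts H) (blue H)"

definition purple :: "'a br_graph \<Rightarrow> bool" where
  "purple H \<longleftrightarrow> red H = blue H"

definition irreflexive :: "'a br_graph \<Rightarrow> bool" where
  "irreflexive H \<longleftrightarrow> irrefl (red H) \<and> irrefl (blue H)"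

definition leaf :: "('a \<times> 'a) set \<Rightarrow> 'a \<Rightarrow> bool" where
  "leaf E v \<longleftrightarrow> card {u. (v, u) \<in> E} = 1"


definition min_wrt :: "('a \<times> 'a) set \<Rightarrow> 'a \<Rightarrow> 'a \<Rightarrow> 'a" where
  "min_wrt le a b = (if (a, b) \<in> le then a else b)"

definition min_ordering :: "'a set \<Rightarrow> ('a \<times> 'a) set \<Rightarrow> ('a \<times> 'a) set \<Rightarrow> bool" where
  "min_ordering V E le \<longleftrightarrow> linear_order_on V le \<and>
     (\<forall>a a' b b'. (a, b') \<in> E \<longrightarrow> (a', b) \<in> E \<longrightarrow> (min_wrt le a a', min_wrt le b b') \<in> E)"

text \<open>
  Read literally, the condition of \<open>min_ordering\<close> applies to the two orientations \<open>(u, v)\<close> and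
  \<open>(v, u)\<close> of a single edge, and then requires a loop at the smaller endpoint. An irreflexive graph
  with an edge therefore has no min-ordering in that sense. For irreflexive graphs the usual notion
  is the bipartite one: the graph is bipartite, and in the condition \<open>a, a'\<close> lie in one part and
  \<open>b, b'\<close> in the other. The order is still a linear order of all vertices; how the two parts
  interleave is arbitrary.
\<close>

definition bipartition :: "'a set \<Rightarrow> ('a \<times> 'a) set \<Rightarrow> 'a set \<Rightarrow> 'a set \<Rightarrow> bool" where
  "bipartition V E A B \<longleftrightarrow> A \<union> B = V \<and> A \<inter> B = {} \<and> E \<subseteq> A \<times> B \<union> B \<times> A"

definition bip_min_ordering :: "'a set \<Rightarrow> ('a \<times> 'a) set \<Rightarrow> ('a \<times> 'a) set \<Rightarrow> bool" where
  "bip_min_ordering V E le \<longleftrightarrow> linear_order_on V le \<and>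
     (\<exists>A B. bipartition V E A B \<and>
       (\<forall>a\<in>A. \<forall>a'\<in>A. \<forall>b\<in>B. \<forall>b'\<in>B.
          (a, b') \<in> E \<longrightarrow> (a', b) \<in> E \<longrightarrow> (min_wrt le a a', min_wrt le b b') \<in> E))"

lemma irrefl_min_ordering_no_edges:
  assumes "is_graph V E" "irrefl E" "min_ordering V E le"
  shows "E = {}"
proof (rule ccontr)
  assume "E \<noteq> {}"
  then obtain u v where uv: "(u, v) \<in> E" by auto
  have vu: "(v, u) \<in> E" using assms(1) uv by (auto simp: is_graph_def dest: symD)
  have "(min_wrt le u v, min_wrt le u v) \<in> E"
    using assms(3) uv vu unfolding min_ordering_def by blast
  then show False using assms(2) by (auto simp: irrefl_def)
qed

text \<open>So a statement about \<open>bip_min_ordering\<close> also covers the literal reading.\<close>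

lemma irrefl_min_ordering_imp_bip:
  assumes "is_graph V E" "irrefl E" "min_ordering V E le"
  shows "bip_min_ordering V E le"
proof -
  have "E = {}" using irrefl_min_ordering_no_edges[OF assms] .
  then show ?thesis
    using assms(3) unfolding bip_min_ordering_def min_ordering_def bipartition_def by blast
qed


definition above :: "('a \<times> 'a) set \<Rightarrow> 'a \<Rightarrow> 'a \<Rightarrow> bool" where
  "above le r u \<longleftrightarrow> (r, u) \<in> le \<and> u \<noteq> r"

definition removed_blue :: "'a br_graph \<Rightarrow> ('a \<times> 'a) set \<Rightarrow> 'a \<Rightarrow> 'a set \<Rightarrow> ('a \<times> 'a) set" where
  "removed_blue H le r L =
     {(u, v) \<in> blue H. above le r u \<and> above le r v} \<union> {(u, v) \<in> blue H. u \<in> L \<or> v \<in> L}"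

definition remove_blue :: "'a br_graph \<Rightarrow> ('a \<times> 'a) set \<Rightarrow> 'a br_graph" where
  "remove_blue H F = H\<lparr>blue := blue H - F\<rparr>"


definition switch :: "'a \<times> nat \<Rightarrow> 'a \<times> nat" where
  "switch x = (fst x, if snd x = 1 then 2 else 1)"

definition switching_graph :: "'a br_graph \<Rightarrow> ('a \<times> nat) br_graph" where
  "switching_graph H =
     \<lparr>verts = verts H \<times> {1, 2},
      red = {((u, i), (v, j)) | u v i j. i \<in> {1, 2} \<and> j \<in> {1, 2} \<and>
               ((u, v) \<in> red H \<and> i = j \<or> (u, v) \<in> blue H \<and> i \<noteq> j)},
      blue = {((u, i), (v, j)) | u v i j. i \<in> {1, 2} \<and> j \<in> {1, 2} \<and>
               ((u, v) \<in> blue H \<and> i = j \<or> (u, v) \<in> red H \<and> i \<noteq> j)}\<rparr>"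


text \<open>Operations are total functions on the type; only their values on the vertex set matter.\<close>

definition preserves :: "('b \<Rightarrow> 'b \<Rightarrow> 'b \<Rightarrow> 'b) \<Rightarrow> ('b \<times> 'b) set \<Rightarrow> bool" where
  "preserves \<phi> E \<longleftrightarrow> (\<forall>x y z x' y' z'. (x, x') \<in> E \<longrightarrow> (y, y') \<in> E \<longrightarrow> (z, z') \<in> E \<longrightarrow>
     (\<phi> x y z, \<phi> x' y' z') \<in> E)"

definition ternary_polymorphism :: "'b br_graph \<Rightarrow> ('b \<Rightarrow> 'b \<Rightarrow> 'b \<Rightarrow> 'b) \<Rightarrow> bool" where
  "ternary_polymorphism G \<phi> \<longleftrightarrow>
     (\<forall>x\<in>verts G. \<forall>y\<in>verts G. \<forall>z\<in>verts G. \<phi> x y z \<in> verts G) \<and>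
     preserves \<phi> (red G) \<and> preserves \<phi> (blue G)"

definition semi_conservative ::
    "('a \<times> nat) br_graph \<Rightarrow> ('a \<times> nat \<Rightarrow> 'a \<times> nat \<Rightarrow> 'a \<times> nat \<Rightarrow> 'a \<times> nat) \<Rightarrow> bool" where
  "semi_conservative G \<phi> \<longleftrightarrow>
     (\<forall>S \<subseteq> verts G. switch ` S = S \<longrightarrow> (\<forall>x\<in>S. \<forall>y\<in>S. \<forall>z\<in>S. \<phi> x y z \<in> S))"

definition wnu :: "'b br_graph \<Rightarrow> ('b \<Rightarrow> 'b \<Rightarrow> 'b \<Rightarrow> 'b) \<Rightarrow> bool" where
  "wnu G \<phi> \<longleftrightarrow> (\<forall>x\<in>verts G. \<phi> x x x = x) \<and>
     (\<forall>x\<in>verts G. \<forall>y\<in>verts G. \<phi> x x y = \<phi> x y x \<and> \<phi> x y x = \<phi> y x x)"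

end

theory Submission
  imports Defs
begin

text \<open>
  Let \<open>E\<close> be the edge set of the purple graph. Move every leaf in \<open>L\<close> with neighbour \<open>p\<close> up to just
  after all the neighbours of \<open>p\<close>; the result is again a min-ordering. On triples within
  one part of the bipartition, the polymorphism takes the minimum \<open>a\<close> in the new order as its vertex;
  on mixed triples it is a projection. The sign of the value matters only where the two
  minima \<open>a\<close>, \<open>b\<close> of three edges span an edge that is not purple. If \<open>a\<close>, \<open>b\<close> lie above \<open>r\<close> (or one of
  them is a leaf in \<open>L\<close> that was moved past such an edge), none of the three edges is purple, and the
  majority of the three signs works. Otherwise \<open>a\<close>, say, is in \<open>L\<close>; thanks to the new order
  the coordinates holding a leaf attached to \<open>b\<close> are exactly those holding \<open>b\<close> on the other side, and the
  sign is read off these coordinates only.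
\<close>

section \<open>Selecting one of three signs\<close>

text \<open>With only two signs in use, the innermost conditional is the majority of
  \<open>i\<close>, \<open>j\<close>, \<open>k\<close>. Otherwise the first flagged sign is
  returned, with \<open>k\<close> as default.\<close>

definition sign_of :: "bool \<Rightarrow> bool \<Rightarrow> bool \<Rightarrow> nat \<Rightarrow> nat \<Rightarrow> nat \<Rightarrow> nat" where
  "sign_of I J K i j k =
     (if I \<and> J \<and> K then (if j = k then j else i) else if I then i else if J then j else k)"

lemma sign_of_in: "sign_of I J K i j k \<in> {i, j, k}"
  by (simp add: sign_of_def)

lemma sign_of_same: "sign_of I J K i i i = i"
  by (simp add: sign_of_def)

text \<open>Equal arguments carry equal flags and signs, so unless all three are flagged the flagged
  signs agree and their positions do not matter.\<close>

lemma sign_of_wnu: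
  "I \<or> K \<Longrightarrow> sign_of I I K i i k = sign_of I K I i k i \<and> sign_of I K I i k i = sign_of K I I k i i"
  by (auto simp add: sign_of_def)

text \<open>Both sides use the same flags. So either the same flagged coordinate is selected twice,
  or both values are majorities, and majority commutes with exchanging the two signs.\<close>

lemma sign_of_parity:
  assumes "i \<in> {1, 2}" "j \<in> {1, 2}" "k \<in> {1, 2}" "i' \<in> {1, 2}" "j' \<in> {1, 2}" "k' \<in> {1, 2}"
    and "I \<or> J \<or> K"
    and "I \<Longrightarrow> (i = i') = Q" "J \<Longrightarrow> (j = j') = Q" "K \<Longrightarrow> (k = k') = Q"
  shows "(sign_of I J K i j k = sign_of I J K i' j' k') = Q"
  using assms by (cases Q) (auto simp: sign_of_def)

section \<open>Bipartite min-orderings with a set of leaves\<close>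

locale leafy_min_ordering =
  fixes A B :: "'a set" and E le :: "('a \<times> 'a) set" and r :: 'a and L :: "'a set"
  assumes disj: "A \<inter> B = {}"
    and E_sub: "E \<subseteq> A \<times> B \<union> B \<times> A"
    and sym_E: "sym E"
    and lin: "linear_order_on (A \<union> B) le"
    and min_edge: "\<lbrakk>a \<in> A; a' \<in> A; b \<in> B; b' \<in> B; (a, b') \<in> E; (a', b) \<in> E\<rbrakk> \<Longrightarrow>
          (min_wrt le a a', min_wrt le b b') \<in> E"
    and L_sub: "L \<subseteq> {v \<in> A \<union> B. leaf E v}"
begin

lemma E_symD: "(u, v) \<in> E \<Longrightarrow> (v, u) \<in> E"
  using sym_E by (auto dest: symD)

lemma E_side: "(u, v) \<in> E \<Longrightarrow> u \<in> A \<longleftrightarrow> v \<notin> A"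
  using E_sub disj by auto

lemma E_verts: "(u, v) \<in> E \<Longrightarrow> u \<in> A \<union> B \<and> v \<in> A \<union> B"
  using E_sub by auto

lemma le_refl: "v \<in> A \<union> B \<Longrightarrow> (v, v) \<in> le"
  using lin by (auto simp: order_on_defs refl_on_def)

lemma le_trans: "(u, v) \<in> le \<Longrightarrow> (v, w) \<in> le \<Longrightarrow> (u, w) \<in> le"
  using lin by (auto simp: order_on_defs dest: transD)

lemma le_antisym: "(u, v) \<in> le \<Longrightarrow> (v, u) \<in> le \<Longrightarrow> u = v"
  using lin by (auto simp: order_on_defs dest: antisymD)

lemma le_total: "u \<in> A \<union> B \<Longrightarrow> v \<in> A \<union> B \<Longrightarrow> (u, v) \<in> le \<or> (v, u) \<in> le"
  using lin le_refl by (cases "u = v") (auto simp: order_on_defs total_on_def)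

text \<open>Symmetry of \<open>E\<close> exchanges the roles of \<open>A\<close> and
  \<open>B\<close> in \<open>min_edge\<close>, so later arguments need not know which part contains
  \<open>a\<close>.\<close>

lemma le_crossing:
  assumes "(a, b') \<in> E" "(a', b) \<in> E" "(a, a') \<in> le" "(b, b') \<in> le" "a \<in> A \<longleftrightarrow> a' \<in> A"
  shows "(a, b) \<in> E"
proof (cases "a \<in> A")
  case True
  then have "b' \<in> B" "b \<in> B" "a' \<in> A"
    using assms E_sub disj by auto
  from min_edge[OF True this(3,2,1) assms(1,2)] show ?thesis
    using assms by (simp add: min_wrt_def)
next
  case False
  then have "b \<in> A" "b' \<in> A" "a \<in> B" "a' \<in> B"
    using assms E_sub disj by auto
  from min_edge[OF this E_symD[OF assms(2)] E_symD[OF assms(1)]] show ?thesis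
    using assms by (auto simp: min_wrt_def dest: E_symD)
qed

lemma L_nbr: "l \<in> L \<Longrightarrow> \<exists>p. (l, p) \<in> E"
  using L_sub by (force simp: leaf_def card_1_singleton_iff)

lemma L_unique:
  assumes "l \<in> L" "(l, p) \<in> E" "(l, q) \<in> E"
  shows "p = q"
proof -
  have "card {u. (l, u) \<in> E} = 1" using assms(1) L_sub by (auto simp: leaf_def)
  then obtain u where "{u. (l, u) \<in> E} = {u}" by (rule card_1_singletonE)
  then show ?thesis using assms(2,3) by (metis mem_Collect_eq singletonD)
qed

section \<open>Moving the leaves of \<open>L\<close> up\<close>

text \<open>The down-set of the old order after which a vertex sits in the new order.\<close>

definition down :: "'a \<Rightarrow> 'a set" where
  "down v = (if v \<in> L then {w. \<exists>p n. (v, p) \<in> E \<and> (p, n) \<in> E \<and> (w, n) \<in> le} else {w. (w, v) \<in> le})"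

text \<open>Down-sets stand in for the last neighbour of \<open>p\<close>, which need not exist in
  an infinite graph. The tie-break puts a leaf of \<open>L\<close> after even the largest neighbour
  of \<open>p\<close> outside \<open>L\<close>.\<close>

definition moved :: "'a \<Rightarrow> 'a \<Rightarrow> bool" where
  "moved v w \<longleftrightarrow> down v \<subset> down w \<or>
     (down v = down w \<and> (v \<notin> L \<and> w \<in> L \<or> (v \<in> L \<longleftrightarrow> w \<in> L) \<and> (v, w) \<in> le))"

lemma down_self: "v \<in> A \<union> B \<Longrightarrow> v \<in> down v"
  using L_nbr E_symD le_refl by (fastforce simp: down_def)

lemma down_closed: "w \<in> down v \<Longrightarrow> (u, w) \<in> le \<Longrightarrow> u \<in> down v"
  by (cases "v \<in> L") (auto simp: down_def intro: le_trans)

lemma down_verts: "down v \<subseteq> A \<union> B"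
  using lin by (auto simp: down_def order_on_defs refl_on_def split: if_splits)

lemma down_total: "down v \<subseteq> down w \<or> down w \<subseteq> down v"
  using down_closed down_verts le_total by blast

lemma moved_refl: "v \<in> A \<union> B \<Longrightarrow> moved v v"
  by (simp add: moved_def le_refl)

lemma moved_total: "v \<in> A \<union> B \<Longrightarrow> w \<in> A \<union> B \<Longrightarrow> moved v w \<or> moved w v"
  using down_total[of v w] le_total[of v w] by (auto simp: moved_def)

lemma moved_antisym: "moved v w \<Longrightarrow> moved w v \<Longrightarrow> v = w"
  using le_antisym by (auto simp: moved_def)

lemma moved_trans: "moved u v \<Longrightarrow> moved v w \<Longrightarrow> moved u w"
  using le_trans unfolding moved_def by (metis psubset_trans)

lemma moved_down: "v \<in> A \<union> B \<Longrightarrow> moved v w \<Longrightarrow> v \<in> down w"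
  using down_self by (auto simp: moved_def)

text \<open>If \<open>moved a a'\<close> holds without \<open>(a, a') \<in> le\<close>, then
  \<open>a'\<close> is a leaf at \<open>b\<close> and \<open>a\<close> lies below some neighbour
  \<open>n\<close> of \<open>b\<close>; the edge from \<open>n\<close> to \<open>b\<close> then
  replaces that from \<open>a'\<close> to \<open>b\<close>. The same works for \<open>b\<close> and
  \<open>b'\<close>.\<close>

lemma moved_crossing:
  assumes "(a, b') \<in> E" "(a', b) \<in> E" "moved a a'" "moved b b'" "a \<in> A \<longleftrightarrow> a' \<in> A"
  shows "(a, b) \<in> E"
proof -
  have aV: "a \<in> A \<union> B" "b \<in> A \<union> B" "a' \<in> A \<union> B" "b' \<in> A \<union> B"
    using assms E_verts by blast+
  have a: "(a, a') \<in> le \<or> (a' \<in> L \<and> (\<exists>n. (b, n) \<in> E \<and> (a, n) \<in> le))"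
    using moved_down[OF aV(1) assms(3)] L_unique assms(2)
    by (auto simp: down_def split: if_splits)
  have b: "(b, b') \<in> le \<or> (b' \<in> L \<and> (\<exists>n. (a, n) \<in> E \<and> (b, n) \<in> le))"
    using moved_down[OF aV(2) assms(4)] L_unique E_symD[OF assms(1)]
    by (auto simp: down_def split: if_splits)
  have a_le: "(a, b) \<in> E" if "(b, b') \<in> le"
    using a
  proof (elim disjE conjE exE)
    assume "(a, a') \<in> le"
    then show ?thesis using le_crossing assms that by blast
  next
    fix n assume n: "(b, n) \<in> E" "(a, n) \<in> le"
    have "a \<in> A \<longleftrightarrow> n \<in> A" using assms(2,5) n(1) E_side by blast
    then show ?thesis using le_crossing[OF assms(1) E_symD[OF n(1)] n(2) that] by blast
  qed
  have b_le: "(a, b) \<in> E" if "(a, a') \<in> le"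
    using b
  proof (elim disjE conjE exE)
    assume "(b, b') \<in> le"
    then show ?thesis using a_le by blast
  next
    fix n assume n: "(a, n) \<in> E" "(b, n) \<in> le"
    then show ?thesis using le_crossing[OF n(1) assms(2) that n(2) assms(5)] by blast
  qed
  \<comment> \<open>It remains to treat the case where \<open>le\<close> orders neither pair as
    \<open>moved\<close> does. Crossing the other way gives the edge \<open>(a', b')\<close>, and
    the leaf \<open>b'\<close> has only one neighbour.\<close>
  show ?thesis
  proof (rule ccontr)
    assume no: "(a, b) \<notin> E"
    then have "b' \<in> L" "(a', a) \<in> le" "(b', b) \<in> le"
      using a_le b_le b le_total aV by blast+
    then have "(a', b') \<in> E"
      using le_crossing[OF assms(2,1)] assms(5) by blast
    then have "a = a'" using L_unique[OF \<open>b' \<in> L\<close>] assms(1) E_symD by blast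
    then show False using no assms(2) by blast
  qed
qed

section \<open>Ternary minima in the moved order\<close>

definition moved_min :: "'a \<Rightarrow> 'a \<Rightarrow> 'a" where
  "moved_min u v = (if moved u v then u else v)"

definition moved_min3 :: "'a \<Rightarrow> 'a \<Rightarrow> 'a \<Rightarrow> 'a" where
  "moved_min3 u v w = moved_min u (moved_min v w)"

lemma moved_min3_in: "moved_min3 u v w \<in> {u, v, w}"
  by (simp add: moved_min3_def moved_min_def)

lemma moved_min3_le:
  assumes "u \<in> A \<union> B" "v \<in> A \<union> B" "w \<in> A \<union> B"
  shows "moved (moved_min3 u v w) u" "moved (moved_min3 u v w) v" "moved (moved_min3 u v w) w"
  using assms moved_total moved_trans moved_refl
  unfolding moved_min3_def moved_min_def by (smt (verit))+

lemma moved_min3_eqI: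
  assumes "m \<in> {u, v, w}" "moved m u" "moved m v" "moved m w"
    "u \<in> A \<union> B" "v \<in> A \<union> B" "w \<in> A \<union> B"
  shows "moved_min3 u v w = m"
proof (rule moved_antisym)
  show "moved (moved_min3 u v w) m" using assms(1) moved_min3_le[OF assms(5-7)] by auto
  show "moved m (moved_min3 u v w)" using assms(2-4) moved_min3_in[of u v w] by auto
qed

lemma moved_min3_wnu:
  assumes "u \<in> A \<union> B" "v \<in> A \<union> B"
  shows "moved_min3 u v u = moved_min3 u u v" "moved_min3 v u u = moved_min3 u u v"
  using moved_min3_in[of u u v] moved_min3_le[of u u v] assms
  by (auto intro!: moved_min3_eqI)

text \<open>Each minimum has a neighbour in the opposite triple; \<open>moved_crossing\<close>
  applies to these two edges.\<close>

lemma moved_min3_edge: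
  assumes e: "(x, x') \<in> E" "(y, y') \<in> E" "(z, z') \<in> E"
    and side: "x \<in> A \<longleftrightarrow> y \<in> A" "x \<in> A \<longleftrightarrow> z \<in> A"
  shows "(moved_min3 x y z, moved_min3 x' y' z') \<in> E"
proof -
  let ?a = "moved_min3 x y z" and ?b = "moved_min3 x' y' z'"
  have V: "x \<in> A \<union> B" "y \<in> A \<union> B" "z \<in> A \<union> B" "x' \<in> A \<union> B" "y' \<in> A \<union> B" "z' \<in> A \<union> B"
    using e E_verts by blast+
  obtain b0 where b0: "(?a, b0) \<in> E" "b0 \<in> {x', y', z'}"
    using moved_min3_in[of x y z] e by auto
  obtain a0 where a0: "(a0, ?b) \<in> E" "a0 \<in> {x, y, z}"
    using moved_min3_in[of x' y' z'] e by auto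
  have "moved ?a a0" using moved_min3_le[OF V(1-3)] a0(2) by auto
  moreover have "moved ?b b0" using moved_min3_le[OF V(4-6)] b0(2) by auto
  moreover have "?a \<in> A \<longleftrightarrow> a0 \<in> A" using moved_min3_in[of x y z] a0(2) side by auto
  ultimately show ?thesis using moved_crossing[OF b0(1) a0(1)] by blast
qed

section \<open>Purple edges and minima with majority signs\<close>

definition up :: "'a \<Rightarrow> bool" where
  "up v \<longleftrightarrow> v \<notin> L \<and> above le r v"

definition purples :: "('a \<times> 'a) set" where
  "purples = {(u, v) \<in> E. u \<notin> L \<and> v \<notin> L \<and> \<not> (above le r u \<and> above le r v)}"

text \<open>The vertex \<open>w\<close> provides an \<open>up\<close> vertex in the down-set of a
  leaf. Asking for it outside \<open>L\<close> as well makes the predicate agree at the two ends of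
  a non-purple edge.\<close>

definition majority_min :: "'a \<Rightarrow> bool" where
  "majority_min v \<longleftrightarrow> (if v \<in> L then \<exists>p w. (v, p) \<in> E \<and> up p \<and> (p, w) \<in> E \<and> up w
                     else up v \<and> (\<exists>w. (v, w) \<in> E \<and> up w))"

lemma purples_sym: "(u, v) \<in> purples \<longleftrightarrow> (v, u) \<in> purples"
  using E_symD by (auto simp: purples_def)

lemma up_mono: "up u \<Longrightarrow> (u, v) \<in> le \<Longrightarrow> v \<notin> L \<Longrightarrow> up v"
  using le_trans le_antisym unfolding up_def above_def by blast

text \<open>The set \<open>down a\<close> contains an \<open>up\<close> vertex: \<open>a\<close>
  itself or, for a leaf, the neighbour \<open>w\<close> of its parent. It is then in
  \<open>down y\<close>, hence below \<open>y\<close>.\<close>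

lemma majority_min_up:
  assumes "majority_min a" "moved a y" "a \<in> A \<union> B" "y \<notin> L"
  shows "up y"
proof -
  have "\<exists>w. w \<in> down a \<and> up w"
  proof (cases "a \<in> L")
    case True
    then obtain p w where pw: "(a, p) \<in> E" "(p, w) \<in> E" "up w"
      using assms(1) by (auto simp: majority_min_def)
    then have "(w, w) \<in> le" using E_verts le_refl by blast
    then have "w \<in> down a" using True pw by (auto simp: down_def)
    then show ?thesis using pw by blast
  next
    case False
    then show ?thesis using assms down_self by (auto simp: majority_min_def)
  qed
  moreover have "down a \<subseteq> down y" using assms(2) by (auto simp: moved_def)
  ultimately show ?thesis using assms(4) up_mono by (auto simp: down_def)
qed

text \<open>If \<open>a\<close> is in \<open>L\<close>, then \<open>b\<close> is its parent. If not,
  either \<open>b\<close> is a leaf of \<open>L\<close> hanging on \<open>a\<close>, or both ends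
  lie above \<open>r\<close> and \<open>a\<close> serves as the \<open>up\<close> neighbour of
  \<open>b\<close>.\<close>

lemma majority_min_edge:
  assumes "(a, b) \<in> E" "(a, b) \<notin> purples" "majority_min a"
  shows "majority_min b"
proof (cases "a \<in> L")
  case True
  then show ?thesis
    using assms L_unique unfolding majority_min_def up_def by (metis (no_types, lifting))
next
  case False
  then show ?thesis
    using assms E_symD[OF assms(1)] by (auto simp: majority_min_def purples_def up_def)
qed

lemma majority_min_iff:
  assumes "(a, b) \<in> E" "(a, b) \<notin> purples"
  shows "majority_min a \<longleftrightarrow> majority_min b"
  using assms majority_min_edge E_symD purples_sym by blast

lemma majority_min_not_purple:
  assumes "majority_min a" "majority_min b" "moved a y" "moved b y'" "a \<in> A \<union> B" "b \<in> A \<union> B"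
  shows "(y, y') \<notin> purples"
  using majority_min_up[OF assms(1,3,5)] majority_min_up[OF assms(2,4,6)]
  by (auto simp: purples_def up_def)

section \<open>Twin leaves and counted coordinates\<close>

definition twin :: "'a \<Rightarrow> 'a \<Rightarrow> bool" where
  "twin a y \<longleftrightarrow> a = y \<or> (a \<in> L \<and> y \<in> L \<and> (\<exists>p. (a, p) \<in> E \<and> (y, p) \<in> E))"

text \<open>Both twin conditions amount to \<open>y' = b\<close>, and an edge at a leaf of
  \<open>L\<close> is never purple.\<close>

lemma twin_leaf_edge:
  assumes "a \<in> L" "(a, b) \<in> E" "(y, y') \<in> E" "moved a y"
  shows "(twin a y \<longleftrightarrow> twin b y') \<and> (twin a y \<longrightarrow> (y, y') \<notin> purples)"
proof -
  \<comment> \<open>A neighbour of \<open>b\<close> outside \<open>L\<close> comes strictly before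
    the leaf \<open>a\<close> in the moved order, against \<open>moved a y\<close>.\<close>
  have leaf: "y \<in> L" if "y' = b"
  proof (rule ccontr)
    assume y: "y \<notin> L"
    have "(b, y) \<in> E" "(y, y) \<in> le"
      using that E_symD[OF assms(3)] le_refl E_verts[OF assms(3)] by auto
    then have "y \<in> down a" using assms(1,2) by (auto simp: down_def)
    then have "down y \<subseteq> down a" using y down_closed[of y a] by (auto simp: down_def)
    then show False using assms(1,4) y by (auto simp: moved_def)
  qed
  have 1: "y' = b \<and> y \<in> L" if "twin a y"
    using that assms(1-3) L_unique[of a] L_unique[of y] unfolding twin_def by metis
  \<comment> \<open>If \<open>b\<close> is itself in \<open>L\<close>, a common neighbour of
    \<open>b\<close> and \<open>y'\<close> must be \<open>a\<close>, whose only neighbour is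
    \<open>b\<close>.\<close>
  have 2: "y' = b" if "twin b y'"
    using that L_unique[OF assms(1,2)] E_symD L_unique unfolding twin_def
    by (metis assms(2,3))
  have 3: "twin a y" if "y' = b"
    using leaf[OF that] that assms(1-3) unfolding twin_def by blast
  have "twin b y'" if "y' = b" using that by (simp add: twin_def)
  moreover have "(y, y') \<notin> purples" if "y \<in> L" using that by (simp add: purples_def)
  ultimately show ?thesis using 1 2 3 by blast
qed

text \<open>The coordinates from which the sign is read when the minimum is \<open>a\<close>.\<close>

definition counted :: "'a \<Rightarrow> 'a \<Rightarrow> bool" where
  "counted a y \<longleftrightarrow> majority_min a \<or> twin a y"

text \<open>This supplies the hypotheses of \<open>sign_of_parity\<close>: the flags must match on
  both sides, and a purple edge would leave its sign relation open.\<close>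

lemma counted_edge:
  assumes "(a, b) \<in> E" "(a, b) \<notin> purples" "(y, y') \<in> E" "moved a y" "moved b y'"
  shows "(counted a y \<longleftrightarrow> counted b y') \<and> (counted a y \<longrightarrow> (y, y') \<notin> purples)"
proof (cases "majority_min a")
  case True
  then show ?thesis
    using majority_min_iff[OF assms(1,2)] majority_min_not_purple[OF _ _ assms(4,5)]
      E_verts[OF assms(1)] unfolding counted_def by blast
next
  case False
  then have nb: "\<not> majority_min b" using majority_min_iff assms by blast
  \<comment> \<open>A non-purple edge with no end in \<open>L\<close> has both ends
    \<open>up\<close>, which would give \<open>majority_min a\<close>.\<close>
  have "a \<in> L \<or> b \<in> L"
  proof (rule ccontr)
    assume "\<not> (a \<in> L \<or> b \<in> L)"
    then have "up a" "up b" using assms(1,2) by (auto simp: purples_def up_def)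
    then show False using False assms(1) by (auto simp: majority_min_def up_def)
  qed
  then have "(twin a y \<longleftrightarrow> twin b y') \<and> (twin a y \<longrightarrow> (y, y') \<notin> purples)"
    using twin_leaf_edge[OF _ assms(1,3,4)]
      twin_leaf_edge[OF _ E_symD[OF assms(1)] E_symD[OF assms(3)] assms(5)] purples_sym
    by blast
  then show ?thesis using False nb by (simp add: counted_def)
qed

section \<open>The operation on signed vertices\<close>

definition min_op :: "'a \<times> nat \<Rightarrow> 'a \<times> nat \<Rightarrow> 'a \<times> nat \<Rightarrow> 'a \<times> nat" where
  "min_op x y z =
     (let a = moved_min3 (fst x) (fst y) (fst z)
      in (a, sign_of (counted a (fst x)) (counted a (fst y)) (counted a (fst z))
               (snd x) (snd y) (snd z)))"

text \<open>A mixed triple yields its first argument from the part holding two of the three. Edges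
  exchange the parts, so both ends select the same coordinate; if two arguments are equal, the
  repeated one is selected.\<close>

definition wnu_op :: "'a \<times> nat \<Rightarrow> 'a \<times> nat \<Rightarrow> 'a \<times> nat \<Rightarrow> 'a \<times> nat" where
  "wnu_op x y z =
     (if (fst x \<in> A \<longleftrightarrow> fst y \<in> A) \<and> (fst x \<in> A \<longleftrightarrow> fst z \<in> A) then min_op x y z
      else if (fst x \<in> A \<longleftrightarrow> fst y \<in> A) \<or> (fst x \<in> A \<longleftrightarrow> fst z \<in> A) then x else y)"

text \<open>For \<open>Q\<close> true these are the red, for \<open>Q\<close> false the blue edges of the switching graph.\<close>

definition signed_edges :: "bool \<Rightarrow> (('a \<times> nat) \<times> ('a \<times> nat)) set" where
  "signed_edges Q = {(x, y). snd x \<in> {1, 2} \<and> snd y \<in> {1, 2} \<and> (fst x, fst y) \<in> E \<and>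
     ((fst x, fst y) \<in> purples \<or> (snd x = snd y) = Q)}"

lemma min_op_edge:
  assumes e: "(x, x') \<in> signed_edges Q" "(y, y') \<in> signed_edges Q" "(z, z') \<in> signed_edges Q"
    and side: "fst x \<in> A \<longleftrightarrow> fst y \<in> A" "fst x \<in> A \<longleftrightarrow> fst z \<in> A"
  shows "(min_op x y z, min_op x' y' z') \<in> signed_edges Q"
proof -
  define a where "a = moved_min3 (fst x) (fst y) (fst z)"
  define b where "b = moved_min3 (fst x') (fst y') (fst z')"
  have E: "(fst x, fst x') \<in> E" "(fst y, fst y') \<in> E" "(fst z, fst z') \<in> E"
    using e by (auto simp: signed_edges_def)
  have V: "fst x \<in> A \<union> B" "fst y \<in> A \<union> B" "fst z \<in> A \<union> B"
      "fst x' \<in> A \<union> B" "fst y' \<in> A \<union> B" "fst z' \<in> A \<union> B"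
    using E E_verts by blast+
  have ab: "(a, b) \<in> E" using moved_min3_edge[OF E side] by (simp add: a_def b_def)
  have am: "moved a (fst x)" "moved a (fst y)" "moved a (fst z)"
    unfolding a_def using moved_min3_le V by blast+
  have bm: "moved b (fst x')" "moved b (fst y')" "moved b (fst z')"
    unfolding b_def using moved_min3_le V by blast+
  have s: "snd x \<in> {1, 2}" "snd y \<in> {1, 2}" "snd z \<in> {1, 2}"
      "snd x' \<in> {1, 2}" "snd y' \<in> {1, 2}" "snd z' \<in> {1, 2}"
    using e by (auto simp: signed_edges_def)
  have s_op: "snd (min_op x y z) \<in> {1, 2}" "snd (min_op x' y' z') \<in> {1, 2}"
    using sign_of_in s unfolding min_op_def Let_def snd_conv by (metis insert_iff singletonD)+
  have fst_op: "fst (min_op x y z) = a" "fst (min_op x' y' z') = b"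
    by (simp_all add: min_op_def Let_def a_def b_def)
  \<comment> \<open>A purple edge \<open>(a, b)\<close> admits every pair of signs, so the signs
    matter only here.\<close>
  have "(snd (min_op x y z) = snd (min_op x' y' z')) = Q" if np: "(a, b) \<notin> purples"
  proof -
    note cx = counted_edge[OF ab np E(1) am(1) bm(1)]
      and cy = counted_edge[OF ab np E(2) am(2) bm(2)]
      and cz = counted_edge[OF ab np E(3) am(3) bm(3)]
    have "a \<in> {fst x, fst y, fst z}" unfolding a_def by (rule moved_min3_in)
    then have "counted a (fst x) \<or> counted a (fst y) \<or> counted a (fst z)"
      by (auto simp: counted_def twin_def)
    moreover have "counted a (fst x) \<Longrightarrow> (snd x = snd x') = Q"
        "counted a (fst y) \<Longrightarrow> (snd y = snd y') = Q"
        "counted a (fst z) \<Longrightarrow> (snd z = snd z') = Q"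
      using cx cy cz e by (auto simp: signed_edges_def)
    moreover have "counted b (fst x') = counted a (fst x)"
        "counted b (fst y') = counted a (fst y)" "counted b (fst z') = counted a (fst z)"
      using cx cy cz by blast+
    ultimately show ?thesis
      unfolding min_op_def Let_def snd_conv a_def[symmetric] b_def[symmetric]
      using sign_of_parity[OF s, of "counted a (fst x)" "counted a (fst y)" "counted a (fst z)" Q]
      by simp
  qed
  then show ?thesis
    using ab s_op fst_op unfolding signed_edges_def by auto
qed

lemma wnu_op_preserves: "preserves wnu_op (signed_edges Q)"
  unfolding preserves_def
proof (intro allI impI)
  fix x y z x' y' z'
  assume e: "(x, x') \<in> signed_edges Q" "(y, y') \<in> signed_edges Q" "(z, z') \<in> signed_edges Q"
  have side: "fst x' \<in> A \<longleftrightarrow> fst x \<notin> A" "fst y' \<in> A \<longleftrightarrow> fst y \<notin> A" "fst z' \<in> A \<longleftrightarrow> fst z \<notin> A"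
    using e E_side unfolding signed_edges_def by blast+
  show "(wnu_op x y z, wnu_op x' y' z') \<in> signed_edges Q"
    using e min_op_edge[OF e] unfolding wnu_op_def side by auto
qed

lemma wnu_op_fst: "fst (wnu_op x y z) \<in> {fst x, fst y, fst z}"
  using moved_min3_in[of "fst x" "fst y" "fst z"] by (auto simp: wnu_op_def min_op_def Let_def)

lemma wnu_op_snd: "snd (wnu_op x y z) \<in> {snd x, snd y, snd z}"
  using sign_of_in by (auto simp: wnu_op_def min_op_def Let_def)

lemma wnu_op_idem: "wnu_op x x x = x"
  using moved_min3_in[of "fst x" "fst x" "fst x"]
  by (simp add: wnu_op_def min_op_def Let_def sign_of_same)

lemma wnu_op_weakly_symmetric:
  assumes "fst x \<in> A \<union> B" "fst y \<in> A \<union> B"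
  shows "wnu_op x x y = wnu_op x y x \<and> wnu_op x y x = wnu_op y x x"
proof -
  define a where "a = moved_min3 (fst x) (fst x) (fst y)"
  have "a \<in> {fst x, fst x, fst y}" unfolding a_def by (rule moved_min3_in)
  \<comment> \<open>The minimum is one of the two vertices and is its own twin, so
    \<open>sign_of_wnu\<close> applies.\<close>
  then have "counted a (fst x) \<or> counted a (fst y)" by (auto simp: counted_def twin_def)
  then show ?thesis
    using sign_of_wnu[of "counted a (fst x)" "counted a (fst y)"] moved_min3_wnu[OF assms]
    by (auto simp: wnu_op_def min_op_def Let_def a_def)
qed

section \<open>Polymorphism, semi-conservativity and the WNU identities\<close>

lemma wnu_op_ternary_polymorphism:
  assumes "verts G = (A \<union> B) \<times> {1, 2}" "red G = signed_edges True" "blue G = signed_edges False"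
  shows "ternary_polymorphism G wnu_op"
proof -
  have "wnu_op x y z \<in> verts G" if "x \<in> verts G" "y \<in> verts G" "z \<in> verts G" for x y z
  proof -
    have "{fst x, fst y, fst z} \<subseteq> A \<union> B" "{snd x, snd y, snd z} \<subseteq> {1, 2}"
      using that unfolding assms(1) mem_Times_iff by blast+
    then show ?thesis
      unfolding assms(1) mem_Times_iff using wnu_op_fst wnu_op_snd by (meson subsetD)
  qed
  then show ?thesis
    using wnu_op_preserves assms by (auto simp: ternary_polymorphism_def)
qed

lemma wnu_op_semi_conservative:
  assumes "verts G = (A \<union> B) \<times> {1, 2}"
  shows "semi_conservative G wnu_op"
  unfolding semi_conservative_def
proof (intro allI impI ballI)
  fix S x y z assume S: "S \<subseteq> verts G" "switch ` S = S" and xyz: "x \<in> S" "y \<in> S" "z \<in> S"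
  have sg: "snd v \<in> {1, 2}" if "v \<in> S" for v using that S assms by auto
  \<comment> \<open>A set closed under \<open>switch\<close> contains both signed copies of each of
    its vertices, so only the vertex of the value needs control.\<close>
  have both: "(fst v, i) \<in> S" if v: "v \<in> S" and i: "i \<in> {1, 2}" for v i
  proof (cases "snd v = i")
    case True
    then show ?thesis using v by auto
  next
    case False
    then have "switch v = (fst v, i)" using sg[OF v] i by (auto simp: switch_def)
    then show ?thesis using v S(2) by (metis imageI)
  qed
  have "snd (wnu_op x y z) \<in> {1, 2}" using wnu_op_snd[of x y z] sg[OF xyz(1)] sg[OF xyz(2)] sg[OF xyz(3)] by auto
  then have "(fst (wnu_op x y z), snd (wnu_op x y z)) \<in> S"
    using wnu_op_fst[of x y z] both[OF xyz(1)] both[OF xyz(2)] both[OF xyz(3)]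
    by (metis insert_iff singletonD)
  then show "wnu_op x y z \<in> S" by simp
qed

lemma wnu_op_wnu:
  assumes "verts G = (A \<union> B) \<times> {1, 2}"
  shows "wnu G wnu_op"
  unfolding wnu_def
proof (intro conjI ballI)
  fix x y assume "x \<in> verts G" "y \<in> verts G"
  then have "fst x \<in> A \<union> B" "fst y \<in> A \<union> B" unfolding assms mem_Times_iff by blast+
  note * = wnu_op_weakly_symmetric[OF this]
  show "wnu_op x x y = wnu_op x y x" "wnu_op x y x = wnu_op y x x" using * by blast+
qed (rule wnu_op_idem)

end

theorem theorem4p5:
  fixes H_plus :: "'a br_graph" and le :: "('a \<times> 'a) set" and r :: 'a and L :: "'a set"
  assumes "is_br_graph H_plus"
    and "purple H_plus"
    and "irreflexive H_plus"
    and "bip_min_ordering (verts H_plus) (red H_plus) le"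
    and "r \<in> verts H_plus"
    and "L \<subseteq> {v \<in> verts H_plus. leaf (red H_plus) v}"
  defines "H \<equiv> remove_blue H_plus (removed_blue H_plus le r L)"
  shows "\<exists>\<phi>. ternary_polymorphism (switching_graph H) \<phi> \<and>
             semi_conservative (switching_graph H) \<phi> \<and>
             wnu (switching_graph H) \<phi>"
proof -
  obtain A B where AB: "bipartition (verts H_plus) (red H_plus) A B"
    and mo: "\<forall>a\<in>A. \<forall>a'\<in>A. \<forall>b\<in>B. \<forall>b'\<in>B. (a, b') \<in> red H_plus \<longrightarrow> (a', b) \<in> red H_plus \<longrightarrow>
          (min_wrt le a a', min_wrt le b b') \<in> red H_plus"
    and lin: "linear_order_on (verts H_plus) le"
    using assms(4) unfolding bip_min_ordering_def by blast
  have V: "verts H_plus = A \<union> B" using AB by (simp add: bipartition_def)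
  interpret leafy_min_ordering A B "red H_plus" le r L
  proof
    show "A \<inter> B = {}" "red H_plus \<subseteq> A \<times> B \<union> B \<times> A" using AB by (simp_all add: bipartition_def)
    show "sym (red H_plus)" using assms(1) by (simp add: is_br_graph_def is_graph_def)
    show "linear_order_on (A \<union> B) le" using lin V by simp
    show "L \<subseteq> {v \<in> A \<union> B. leaf (red H_plus) v}" using assms(6) V by simp
  qed (use mo in blast)
  have red: "red H = red H_plus" and verts: "verts H = A \<union> B"
    by (simp_all add: H_def remove_blue_def V)
  have blue: "blue H = purples"
  proof -
    have "blue H = red H_plus - removed_blue H_plus le r L"
      using assms(2) by (simp add: H_def remove_blue_def purple_def)
    moreover have "blue H_plus = red H_plus" using assms(2) by (simp add: purple_def)
    ultimately show ?thesis unfolding removed_blue_def purples_def by blast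
  qed
  \<comment> \<open>Every blue edge of \<open>H\<close> is also red. So an edge is either purple and
    admits all sign pairs in both colours, or red only, and then equality of signs determines the
    colour.\<close>
  have sub: "purples \<subseteq> red H_plus" by (auto simp: purples_def)
  have "Defs.verts (switching_graph H) = (A \<union> B) \<times> {1, 2}"
    by (simp add: switching_graph_def verts)
  moreover have "Defs.red (switching_graph H) = signed_edges True"
    using sub by (auto simp: switching_graph_def signed_edges_def red blue)
  moreover have "Defs.blue (switching_graph H) = signed_edges False"
    using sub by (auto simp: switching_graph_def signed_edges_def red blue)
  ultimately show ?thesis
    using wnu_op_ternary_polymorphism wnu_op_semi_conservative wnu_op_wnu by blast
qed

end
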